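(* Let $\mathcal{H}$ be a real Hilbert space, let $m$ and $r$ be integers with $2\leq r\leq m-1$, and let $C_0,C_1,\ldots,C_{m-1}\subseteq\mathcal{H}$ be nonempty, closed and convex sets. Let $S_1,\ldots,S_m$ be the cyclic $r$-sets-Douglas-Rachford operators associated with $C_0,\ldots,C_{m-1}$ and $r$ (defined in the context), and let $Q:=S_m\cdots S_2S_1$. If $\operatorname{int}\left(\bigcap_{i=0}^{m-1}C_i\right)\neq\emptyset$, then for every $x^0\in\mathcal{H}$ the sequence $\{x^k\}_{k=0}^{\infty}$ generated by $x^{k+1}=Q(x^k)$, $k\geq 0$, converges weakly to a point $x^{\ast}\in\bigcap_{i=0}^{m-1}C_i$.
   Context: For a nonempty closed convex set $D\subseteq\mathcal{H}$, $P_D$ denotes the metric (orthogonal) projection onto $D$, $\mathrm{Id}$ the identity operator on $\mathcal{H}$, and $\mathcal{R}_D:=2P_D-\mathrm{Id}$ the reflection with respect to $D$. For a finite sequence of $r\geq 2$ nonempty closed convex sets $D_0,D_1,\ldots,D_{r-1}\subseteq\mathcal{H}$, the composite reflection operator is $\mathcal{V}_{D_0,\ldots,D_{r-1}}:=\mathcal{R}_{D_{r-1}}\mathcal{R}_{D_{r-2}}\cdots\mathcal{R}_{D_0}$ (so $\mathcal{R}_{D_0}$ is applied first), and the $r$-sets-Douglas-Rachford operator is $\mathcal{T}_{D_0,\ldots,D_{r-1}}:=\frac12\left(\mathrm{Id}+\mathcal{V}_{D_0,\ldots,D_{r-1}}\right)$. Given sets $C_0,\ldots,C_{m-1}$ and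 an integer $r\geq 2$, for each integer $d\geq 1$ the operator $S_d:\mathcal{H}\to\mathcal{H}$ is defined as $S_d:=\mathcal{T}_{D_0,\ldots,D_{r-1}}$ with $D_j:=C_{((r-1)(d-1)+j)\bmod m}$ for $j=0,1,\ldots,r-1$. (Thus the last set used in $S_d$ is the first set used in $S_{d+1}$.) Products of operators denote composition, with the rightmost applied first. *)

theory Defs
  imports "HOL-Analysis.Analysis"
begin

text \<open>Throughout, a real Hilbert space is a type of sort \<open>{real_inner, complete_space}\<close>.
  The library's \<open>closest_point\<close> and its theory require \<open>heine_borel\<close>, i.e. finite dimension,
  and are therefore not used.\<close>

text \<open>Meaningful for nonempty closed convex \<open>D\<close> in a Hilbert space, where the nearest point exists
  and is unique.\<close>

definition metric_projection :: "'a::real_inner set \<Rightarrow> 'a \<Rightarrow> 'a" where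
  "metric_projection D x = (THE p. p \<in> D \<and> (\<forall>y\<in>D. dist x p \<le> dist x y))"

definition reflection :: "'a::real_inner set \<Rightarrow> 'a \<Rightarrow> 'a" where
  "reflection D x = 2 *\<^sub>R metric_projection D x - x"

text \<open>A finite sequence of sets is given as a list. Note that
  \<open>fold f [a, \<dots>, z] = f z \<circ> \<dots> \<circ> f a\<close>, so the head of the list is applied first.\<close>

definition composite_reflection :: "'a::real_inner set list \<Rightarrow> 'a \<Rightarrow> 'a" where
  "composite_reflection Ds = fold reflection Ds"

definition sets_DR_operator :: "'a::real_inner set list \<Rightarrow> 'a \<Rightarrow> 'a" where
  "sets_DR_operator Ds x = (1/2) *\<^sub>R (x + composite_reflection Ds x)"

text \<open>The operator \<open>S\<^sub>d\<close>, for \<open>d \<ge> 1\<close> and \<open>r \<ge> 2\<close> (so no subtraction below is truncated).\<close>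

definition cyclic_DR_operator ::
    "(nat \<Rightarrow> 'a::real_inner set) \<Rightarrow> nat \<Rightarrow> nat \<Rightarrow> nat \<Rightarrow> 'a \<Rightarrow> 'a" where
  "cyclic_DR_operator C m r d =
     sets_DR_operator (map (\<lambda>j. C (((r - 1) * (d - 1) + j) mod m)) [0..<r])"

text \<open>The operator \<open>Q = S\<^sub>m \<circ> \<dots> \<circ> S\<^sub>1\<close>; again \<open>fold\<close> applies \<open>S\<^sub>1\<close> first.\<close>

definition cyclic_DR_sweep ::
    "(nat \<Rightarrow> 'a::real_inner set) \<Rightarrow> nat \<Rightarrow> nat \<Rightarrow> 'a \<Rightarrow> 'a" where
  "cyclic_DR_sweep C m r = fold (cyclic_DR_operator C m r) [1..<Suc m]"

text \<open>Weak convergence of a sequence in an inner product space, tested against the functionals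
  \<open>\<lambda>v. v \<bullet> u\<close>; in a Hilbert space these are all the bounded linear functionals.\<close>

definition weakly_converges_to :: "(nat \<Rightarrow> 'a::real_inner) \<Rightarrow> 'a \<Rightarrow> bool" where
  "weakly_converges_to x l \<longleftrightarrow> (\<forall>u. (\<lambda>k. x k \<bullet> u) \<longlonglongrightarrow> l \<bullet> u)"

end

theory Submission
  imports Defs
begin

text \<open>
  If the nonexpansive map \<open>T\<close> fixes a ball of radius \<open>e\<close> about \<open>z\<close>, then
  \<open>2 e \<parallel>u - T u\<parallel> \<le> \<parallel>u - z\<parallel>\<^sup>2 - \<parallel>T u - z\<parallel>\<^sup>2\<close>. Hence points moved by \<open>T\<close> come strictly closer
  to \<open>z\<close>, and a composition of such maps fixes exactly the common fixed points of its factors;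
  for reflections and for the sweep \<open>Q\<close> this means the intersection of the sets. Moreover, the
  inequality telescopes along an orbit of \<open>T\<close>, so that orbits have finite length and converge,
  even in norm, to a fixed point.
\<close>

section \<open>Projections and reflections\<close>

text \<open>Parallelogram law: convexity puts the midpoint of \<open>a\<close> and \<open>b\<close>
  in \<open>D\<close>, so its squared distance to \<open>x\<close> is at least \<open>s\<close>.
  This makes minimizing sequences Cauchy.\<close>

lemma convex_minimizers_close:
  fixes x :: "'a::real_inner"
  assumes "convex D" "a \<in> D" "b \<in> D" and lb: "\<And>y. y \<in> D \<Longrightarrow> s \<le> (dist x y)\<^sup>2"
  shows "(dist a b)\<^sup>2 \<le> 2 * (dist x a)\<^sup>2 + 2 * (dist x b)\<^sup>2 - 4 * s"
proof -
  have "(1/2) *\<^sub>R a + (1/2) *\<^sub>R b \<in> D"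
    using assms(1-3) by (intro convexD) auto
  from lb[OF this] have "s \<le> (dist x ((1/2) *\<^sub>R a + (1/2) *\<^sub>R b))\<^sup>2" .
  then show ?thesis
    unfolding dist_norm power2_norm_eq_inner
    by (simp add: inner_diff inner_add inner_commute algebra_simps)
qed

text \<open>Completeness replaces compactness: a minimizing sequence is Cauchy, and its limit stays
  in the closed set \<open>D\<close>.\<close>

lemma nearest_point_exists:
  fixes D :: "'a::{real_inner, complete_space} set"
  assumes "D \<noteq> {}" "closed D" "convex D"
  shows "\<exists>p\<in>D. \<forall>y\<in>D. dist x p \<le> dist x y"
proof -
  define s where "s = (INF y\<in>D. (dist x y)\<^sup>2)"
  have bdd: "bdd_below ((\<lambda>y. (dist x y)\<^sup>2) ` D)"
    by (rule bdd_belowI2[of _ 0]) simp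
  then have lb: "s \<le> (dist x y)\<^sup>2" if "y \<in> D" for y
    unfolding s_def using that by (rule cINF_lower)
  have "\<exists>y\<in>D. (dist x y)\<^sup>2 < s + 1 / Suc n" for n
    using cINF_less_iff[OF assms(1) bdd, of "s + 1 / Suc n"] by (simp add: s_def)
  then obtain y where yD: "\<And>n. y n \<in> D" and y: "\<And>n. (dist x (y n))\<^sup>2 < s + 1 / Suc n"
    by metis
  have "Cauchy y"
    unfolding Cauchy_altdef2
  proof (intro allI impI)
    fix e :: real assume "0 < e"
    \<comment> \<open>In the midpoint bound \<open>s\<close> cancels, leaving
      \<open>2 / Suc n + 2 / Suc N\<close>, which is at most \<open>4 / Suc N\<close>; hence the
      threshold \<open>e\<^sup>2 / 4\<close>.\<close>
    then obtain N :: nat where N: "1 / Suc N < e\<^sup>2 / 4"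
      using nat_approx_posE[of "e\<^sup>2 / 4"] by auto
    have "dist (y n) (y N) < e" if "n \<ge> N" for n
    proof -
      have "1 / Suc n \<le> 1 / Suc N"
        using that by (simp add: field_simps)
      then have "(dist (y n) (y N))\<^sup>2 < e\<^sup>2"
        using convex_minimizers_close[OF assms(3) yD[of n] yD[of N] lb] y[of n] y[of N] N by auto
      then show ?thesis
        using \<open>0 < e\<close> by (simp add: power2_less_imp_less)
    qed
    then show "\<exists>N. \<forall>n\<ge>N. dist (y n) (y N) < e" by blast
  qed
  then obtain p where p: "y \<longlonglongrightarrow> p"
    by (auto simp: Cauchy_convergent_iff convergent_def)
  have "(\<lambda>n. (dist x (y n))\<^sup>2) \<longlonglongrightarrow> (dist x p)\<^sup>2"
    by (intro tendsto_intros p)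
  moreover have "(\<lambda>n. s + 1 / Suc n) \<longlonglongrightarrow> s"
    using LIMSEQ_inverse_real_of_nat_add[of s] by (simp add: inverse_eq_divide)
  ultimately have "(dist x p)\<^sup>2 \<le> s"
    using y by (intro LIMSEQ_le) (auto intro: less_imp_le simp del: of_nat_Suc)
  then have "dist x p \<le> dist x z" if "z \<in> D" for z
    using lb[OF that] by (meson order_trans power2_le_imp_le zero_le_dist)
  moreover have "p \<in> D"
    using assms(2) yD p by (rule closed_sequentially)
  ultimately show ?thesis by blast
qed

lemma metric_projection_nearest:
  fixes D :: "'a::{real_inner, complete_space} set"
  assumes "D \<noteq> {}" "closed D" "convex D"
  shows "metric_projection D x \<in> D \<and> (\<forall>y\<in>D. dist x (metric_projection D x) \<le> dist x y)"
  unfolding metric_projection_def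
proof (rule theI')
  show "\<exists>!p. p \<in> D \<and> (\<forall>y\<in>D. dist x p \<le> dist x y)"
  proof (rule ex_ex1I)
    show "\<exists>p. p \<in> D \<and> (\<forall>y\<in>D. dist x p \<le> dist x y)"
      using nearest_point_exists[OF assms] by blast
  next
    fix p q
    assume "p \<in> D \<and> (\<forall>y\<in>D. dist x p \<le> dist x y)" "q \<in> D \<and> (\<forall>y\<in>D. dist x q \<le> dist x y)"
    then show "p = q"
      using any_closest_point_unique[OF assms(3,2)] by blast
  qed
qed

text \<open>Expanding the squared distance of the reflected points leaves, besides
  \<open>(dist x y)\<^sup>2\<close>, four times the variational inequality of each projection tested
  at the other one. Both terms are nonpositive.\<close>

lemma reflection_lipschitz:
  fixes D :: "'a::{real_inner, complete_space} set"
  assumes "D \<noteq> {}" "closed D" "convex D"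
  shows "1-lipschitz_on UNIV (reflection D)"
proof (rule lipschitz_onI)
  fix x y :: 'a
  let ?p = "metric_projection D x" and ?q = "metric_projection D y"
  have "(x - ?p) \<bullet> (?q - ?p) \<le> 0" "(y - ?q) \<bullet> (?p - ?q) \<le> 0"
    by (intro any_closest_point_dot[OF assms(3,2)]; simp add: metric_projection_nearest[OF assms])+
  moreover have "(dist (reflection D x) (reflection D y))\<^sup>2
      = (dist x y)\<^sup>2 + 4 * ((x - ?p) \<bullet> (?q - ?p)) + 4 * ((y - ?q) \<bullet> (?p - ?q))"
    unfolding dist_norm power2_norm_eq_inner reflection_def
    by (simp add: inner_diff inner_commute)
  ultimately have "(dist (reflection D x) (reflection D y))\<^sup>2 \<le> (dist x y)\<^sup>2" by linarith
  from power2_le_imp_le[OF this zero_le_dist]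
  show "dist (reflection D x) (reflection D y) \<le> 1 * dist x y" by simp
qed simp

lemma reflection_fixes_iff:
  fixes D :: "'a::{real_inner, complete_space} set"
  assumes "D \<noteq> {}" "closed D" "convex D"
  shows "reflection D x = x \<longleftrightarrow> x \<in> D"
proof -
  have "reflection D x = x \<longleftrightarrow> 2 *\<^sub>R metric_projection D x = 2 *\<^sub>R x"
    by (simp add: reflection_def algebra_simps scaleR_2)
  also have "\<dots> \<longleftrightarrow> metric_projection D x = x" by simp
  also have "\<dots> \<longleftrightarrow> x \<in> D"
    using metric_projection_nearest[OF assms, of x] by force
  finally show ?thesis .
qed

section \<open>Nonexpansive maps fixing a ball\<close>

text \<open>Shifting the centre from \<open>z\<close> to \<open>z + w\<close> lowers the difference
  of the squared distances by \<open>2 * ((u - v) \<bullet> w)\<close>, yet the difference stays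
  nonnegative on the whole ball. The best shift has length \<open>e\<close> and points along
  \<open>u - v\<close>.\<close>

lemma displacement_le:
  fixes u v z :: "'a::real_inner"
  assumes "0 \<le> e" and closer: "\<And>w. w \<in> cball z e \<Longrightarrow> dist v w \<le> dist u w"
  shows "2 * e * dist u v \<le> (dist u z)\<^sup>2 - (dist v z)\<^sup>2"
proof -
  \<comment> \<open>\<open>sgn 0 = 0\<close> covers the case \<open>u = v\<close>.\<close>
  define w where "w = e *\<^sub>R sgn (u - v)"
  have "norm w \<le> e"
    using assms(1) by (simp add: w_def norm_sgn)
  then have "(dist v (z + w))\<^sup>2 \<le> (dist u (z + w))\<^sup>2"
    by (intro power_mono closer) (auto simp: dist_norm)
  then have "2 * ((u - v) \<bullet> w) \<le> (dist u z)\<^sup>2 - (dist v z)\<^sup>2"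
    unfolding dist_norm power2_norm_eq_inner
    by (simp add: inner_diff inner_add inner_commute algebra_simps)
  moreover have "(u - v) \<bullet> w = e * dist u v"
    by (cases "u = v") (auto simp: w_def sgn_div_norm dist_norm dot_square_norm power2_eq_square)
  ultimately show ?thesis by simp
qed

text \<open>The two properties are bundled because both pass to compositions and to averages with
  the identity, hence from reflections up to the sweep.\<close>

definition nonexpansive_fixing :: "'a::metric_space set \<Rightarrow> ('a \<Rightarrow> 'a) \<Rightarrow> bool" where
  "nonexpansive_fixing Z T \<longleftrightarrow> 1-lipschitz_on UNIV T \<and> (\<forall>z\<in>Z. T z = z)"

lemma nonexpansive_fixing_fold:
  assumes "\<And>a. a \<in> set as \<Longrightarrow> nonexpansive_fixing Z (f a)"
  shows "nonexpansive_fixing Z (fold f as)"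
  using assms
proof (induction as)
  case Nil
  then show ?case by (simp add: nonexpansive_fixing_def lipschitz_on_def)
next
  case (Cons a as)
  then have "nonexpansive_fixing Z (f a)" "nonexpansive_fixing Z (fold f as)" by auto
  then show ?case
    using lipschitz_on_compose[of 1 UNIV "f a" 1 "fold f as"]
    by (auto simp: nonexpansive_fixing_def intro: lipschitz_on_subset)
qed

lemma nonexpansive_fixing_dist:
  assumes "nonexpansive_fixing Z T" "z \<in> Z"
  shows "dist (T u) z \<le> dist u z"
  using assms lipschitz_onD[of 1 UNIV T u z] by (auto simp: nonexpansive_fixing_def)

lemma nonexpansive_fixing_displacement:
  fixes z :: "'a::real_inner"
  assumes "nonexpansive_fixing (cball z e) T" "0 \<le> e"
  shows "2 * e * dist u (T u) \<le> (dist u z)\<^sup>2 - (dist (T u) z)\<^sup>2"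
  using assms by (intro displacement_le nonexpansive_fixing_dist) auto

lemma nonexpansive_fixing_strict:
  fixes z :: "'a::real_inner"
  assumes "nonexpansive_fixing (cball z e) T" "0 < e" "dist u z \<le> dist (T u) z"
  shows "T u = u"
proof -
  have "(dist u z)\<^sup>2 \<le> (dist (T u) z)\<^sup>2"
    using assms(3) by (intro power_mono) auto
  then have "2 * e * dist u (T u) \<le> 0"
    using nonexpansive_fixing_displacement[OF assms(1), of u] assms(2) by linarith
  then show ?thesis
    using assms(2) by (simp add: mult_le_0_iff)
qed

text \<open>If the composition returns to \<open>u\<close>, the first map cannot have moved
  \<open>u\<close> closer to \<open>z\<close>, since the later maps never increase that distance. By
  strictness the first map fixes \<open>u\<close>; induction handles the rest.\<close>

lemma fold_fixes_iff:
  fixes z :: "'a::real_inner"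
  assumes "\<And>a. a \<in> set as \<Longrightarrow> nonexpansive_fixing (cball z e) (f a)" "0 < e"
  shows "fold f as u = u \<longleftrightarrow> (\<forall>a\<in>set as. f a u = u)"
  using assms(1)
proof (induction as)
  case Nil
  then show ?case by simp
next
  case (Cons a as)
  have "f a u = u" if "fold f as (f a u) = u"
  proof (rule nonexpansive_fixing_strict)
    show "nonexpansive_fixing (cball z e) (f a)"
      using Cons.prems by simp
    have "nonexpansive_fixing (cball z e) (fold f as)"
      using Cons.prems by (intro nonexpansive_fixing_fold) simp
    then have "dist (fold f as (f a u)) z \<le> dist (f a u) z"
      by (rule nonexpansive_fixing_dist) (use assms(2) in simp)
    then show "dist u z \<le> dist (f a u) z"
      using that by simp
  qed (rule assms(2))
  then have "fold f (a # as) u = u \<longleftrightarrow> f a u = u \<and> fold f as u = u" by auto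
  also have "\<dots> \<longleftrightarrow> (\<forall>b\<in>set (a # as). f b u = u)"
    using Cons by simp
  finally show ?case .
qed

text \<open>By the triangle inequality, distances along \<open>x\<close> are bounded by increments
  of the convergent partial sums of step lengths.\<close>

lemma summable_dist_imp_Cauchy:
  fixes x :: "nat \<Rightarrow> 'a::metric_space"
  assumes "summable (\<lambda>k. dist (x k) (x (Suc k)))"
  shows "Cauchy x"
proof -
  define s where "s n = (\<Sum>k<n. dist (x k) (x (Suc k)))" for n
  have "Cauchy s"
    unfolding s_def using assms by (simp add: summable_iff_convergent Cauchy_convergent_iff)
  have le: "dist (x m) (x (m + p)) \<le> s (m + p) - s m" for m p
  proof (induction p)
    case (Suc p)
    then show ?case
      using dist_triangle[of "x m" "x (Suc (m + p))" "x (m + p)"] by (simp add: s_def)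
  qed simp
  show ?thesis
    unfolding Cauchy_altdef
  proof (intro allI impI)
    fix e :: real assume "0 < e"
    then obtain N where N: "\<And>m n. N \<le> m \<Longrightarrow> m < n \<Longrightarrow> dist (s m) (s n) < e"
      using \<open>Cauchy s\<close> unfolding Cauchy_altdef by blast
    have "dist (x m) (x n) < e" if "N \<le> m" "m < n" for m n
      using le[of m "n - m"] N[OF that] that by (simp add: dist_real_def)
    then show "\<exists>N. \<forall>m\<ge>N. \<forall>n>m. dist (x m) (x n) < e" by blast
  qed
qed

text \<open>Telescoping bounds the total length of the orbit by
  \<open>(dist (x 0) z)\<^sup>2 / (2 * e)\<close>. Completeness then gives a limit, and continuity
  of \<open>T\<close> makes it a fixed point.\<close>

lemma nonexpansive_fixing_orbit_converges:
  fixes z :: "'a::{real_inner, complete_space}"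
  assumes T: "nonexpansive_fixing (cball z e) T" and "0 < e" and x: "\<And>k. x (Suc k) = T (x k)"
  shows "\<exists>l. x \<longlonglongrightarrow> l \<and> T l = l"
proof -
  have step: "2 * e * dist (x k) (x (Suc k)) \<le> (dist (x k) z)\<^sup>2 - (dist (x (Suc k)) z)\<^sup>2" for k
    using nonexpansive_fixing_displacement[OF T, of "x k"] assms(2) x[of k] by simp
  have "(\<Sum>k<n. 2 * e * dist (x k) (x (Suc k))) \<le> (dist (x 0) z)\<^sup>2" for n
  proof -
    have "(\<Sum>k<n. 2 * e * dist (x k) (x (Suc k)))
        \<le> (\<Sum>k<n. (dist (x k) z)\<^sup>2 - (dist (x (Suc k)) z)\<^sup>2)"
      by (intro sum_mono step)
    also have "\<dots> = (dist (x 0) z)\<^sup>2 - (dist (x n) z)\<^sup>2"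
      by (rule sum_lessThan_telescope')
    finally show ?thesis
      using zero_le_power2[of "dist (x n) z"] by linarith
  qed
  then have "summable (\<lambda>k. 2 * e * dist (x k) (x (Suc k)))"
    using assms(2) by (intro summableI_nonneg_bounded) auto
  then have "summable (\<lambda>k. dist (x k) (x (Suc k)))"
    using assms(2) by (subst (asm) summable_cmult_iff) simp
  then have "Cauchy x"
    by (rule summable_dist_imp_Cauchy)
  then obtain l where l: "x \<longlonglongrightarrow> l"
    by (auto simp: Cauchy_convergent_iff convergent_def)
  have "continuous_on UNIV T"
    using T lipschitz_on_continuous_on unfolding nonexpansive_fixing_def by blast
  then have "(\<lambda>k. T (x k)) \<longlonglongrightarrow> T l"
    using l by (auto intro: continuous_on_tendsto_compose)
  moreover have "(\<lambda>k. T (x k)) \<longlonglongrightarrow> l"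
    using LIMSEQ_Suc[OF l] by (simp add: x)
  ultimately show ?thesis
    using l LIMSEQ_unique by blast
qed

section \<open>Douglas--Rachford operators\<close>

lemma sets_DR_operator_fixes_iff:
  "sets_DR_operator Ds u = u \<longleftrightarrow> composite_reflection Ds u = u"
proof -
  \<comment> \<open>Writing \<open>u\<close> as half of \<open>u + u\<close> allows the factor to be
    cancelled; \<open>scaleR_half_double\<close> is disabled below so that this form
    survives.\<close>
  have "sets_DR_operator Ds u = u \<longleftrightarrow> (1/2) *\<^sub>R (u + composite_reflection Ds u) = (1/2) *\<^sub>R (u + u)"
    by (simp add: sets_DR_operator_def scaleR_half_double)
  then show ?thesis by (simp del: scaleR_half_double)
qed

lemma nonexpansive_fixing_reflection:
  fixes D :: "'a::{real_inner, complete_space} set"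
  assumes "closed D" "convex D" "D \<noteq> {}" "Z \<subseteq> D"
  shows "nonexpansive_fixing Z (reflection D)"
  using assms by (auto simp: nonexpansive_fixing_def reflection_lipschitz reflection_fixes_iff)

lemma nonexpansive_fixing_sets_DR_operator:
  fixes Z :: "'a::{real_inner, complete_space} set"
  assumes "\<And>D. D \<in> set Ds \<Longrightarrow> closed D \<and> convex D \<and> D \<noteq> {} \<and> Z \<subseteq> D"
  shows "nonexpansive_fixing Z (sets_DR_operator Ds)"
proof -
  have V: "nonexpansive_fixing Z (composite_reflection Ds)"
    unfolding composite_reflection_def
    using assms by (intro nonexpansive_fixing_fold nonexpansive_fixing_reflection) auto
  \<comment> \<open>The constant has the shape produced by the rules for scaling and sums: one
    summand from the identity, one from the composite reflection.\<close>
  then have "(1/2 * (1 + 1))-lipschitz_on UNIV (sets_DR_operator Ds)"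
    unfolding nonexpansive_fixing_def sets_DR_operator_def [abs_def]
    by (intro lipschitz_on_cmult_nonneg lipschitz_on_add lipschitz_on_id) auto
  then show ?thesis
    using V by (auto simp: nonexpansive_fixing_def sets_DR_operator_fixes_iff)
qed

text \<open>The common ball rules out spurious fixed points, such as those arising when two
  reflections in the same single point compose to the identity.\<close>

lemma sets_DR_operator_fixes_iff_Inter:
  fixes z :: "'a::{real_inner, complete_space}"
  assumes Ds: "\<And>D. D \<in> set Ds \<Longrightarrow> closed D \<and> convex D \<and> D \<noteq> {} \<and> cball z e \<subseteq> D" and "0 < e"
  shows "sets_DR_operator Ds u = u \<longleftrightarrow> u \<in> \<Inter>(set Ds)"
proof -
  have "fold reflection Ds u = u \<longleftrightarrow> (\<forall>D\<in>set Ds. reflection D u = u)"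
    using Ds by (intro fold_fixes_iff[OF _ assms(2)] nonexpansive_fixing_reflection) auto
  also have "\<dots> \<longleftrightarrow> u \<in> \<Inter>(set Ds)"
    using Ds by (simp add: reflection_fixes_iff)
  finally show ?thesis
    by (simp add: sets_DR_operator_fixes_iff composite_reflection_def)
qed

lemma cyclic_index_covered:
  fixes i m r :: nat
  assumes "2 \<le> r" "i < m"
  obtains d j where "1 \<le> d" "d \<le> m" "j < r" "((r - 1) * (d - 1) + j) mod m = i"
proof
  \<comment> \<open>Consecutive operators advance by \<open>r - 1\<close> indices, so division of
    \<open>i\<close> by \<open>r - 1\<close> yields \<open>d - 1\<close> as quotient and
    \<open>j\<close> as remainder. The resulting index is \<open>i\<close> itself, before any
    wrap-around.\<close>
  show "1 \<le> i div (r - 1) + 1" "i mod (r - 1) < r"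
    using assms mod_less_divisor[of "r - 1" i] by linarith+
  show "i div (r - 1) + 1 \<le> m"
    using assms div_le_dividend[of i "r - 1"] by linarith
  show "((r - 1) * (i div (r - 1) + 1 - 1) + i mod (r - 1)) mod m = i"
    using assms by simp
qed

theorem theorem3p7:
  fixes C :: "nat \<Rightarrow> 'a::{real_inner, complete_space} set"
    and m r :: nat
    and x :: "nat \<Rightarrow> 'a"
  assumes "2 \<le> r" and "r \<le> m - 1"
    and "\<And>i. i < m \<Longrightarrow> C i \<noteq> {}"
    and "\<And>i. i < m \<Longrightarrow> closed (C i)"
    and "\<And>i. i < m \<Longrightarrow> convex (C i)"
    and "interior (\<Inter>i<m. C i) \<noteq> {}"
    and "\<And>k. x (Suc k) = cyclic_DR_sweep C m r (x k)"
  shows "\<exists>xstar \<in> (\<Inter>i<m. C i). weakly_converges_to x xstar"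
proof -
  \<comment> \<open>An interior point supplies one ball that every reflection fixes
    pointwise.\<close>
  obtain z e where e: "0 < e" and ball: "cball z e \<subseteq> (\<Inter>i<m. C i)"
    using assms(6) by (auto simp: mem_interior_cball)
  define Ds where "Ds d = map (\<lambda>j. C (((r - 1) * (d - 1) + j) mod m)) [0..<r]" for d
  have S: "cyclic_DR_operator C m r = (\<lambda>d. sets_DR_operator (Ds d))"
    by (simp add: fun_eq_iff cyclic_DR_operator_def Ds_def)
  have "0 < m" using assms(1,2) by linarith
  have Ds: "closed D \<and> convex D \<and> D \<noteq> {} \<and> cball z e \<subseteq> D" if D: "D \<in> set (Ds d)" for D d
  proof -
    obtain j where "D = C (((r - 1) * (d - 1) + j) mod m)"
      using D by (auto simp: Ds_def)
    moreover have "((r - 1) * (d - 1) + j) mod m < m"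
      using \<open>0 < m\<close> by simp
    ultimately show ?thesis
      using assms(3-5) ball by blast
  qed
  then have S_fixing: "nonexpansive_fixing (cball z e) (cyclic_DR_operator C m r d)" for d
    unfolding S by (rule nonexpansive_fixing_sets_DR_operator)
  then have "nonexpansive_fixing (cball z e) (cyclic_DR_sweep C m r)"
    unfolding cyclic_DR_sweep_def by (intro nonexpansive_fixing_fold)
  from nonexpansive_fixing_orbit_converges[of z e _ x, OF this e assms(7)]
  obtain l where l: "x \<longlonglongrightarrow> l" and "cyclic_DR_sweep C m r l = l" by blast
  \<comment> \<open>A fixed point of the sweep is fixed by each factor, and
    \<open>[1..<Suc m]\<close> runs through exactly the indices 1 to \<open>m\<close>.\<close>
  then have fixed: "sets_DR_operator (Ds d) l = l" if "1 \<le> d" "d \<le> m" for d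
    using fold_fixes_iff[where as = "[1..<Suc m]" and u = l and f = "cyclic_DR_operator C m r", OF S_fixing e] that
    by (simp add: cyclic_DR_sweep_def S del: upt_Suc)
  have "l \<in> C i" if i: "i < m" for i
  proof -
    obtain d j where d: "1 \<le> d" "d \<le> m" and "j < r" "((r - 1) * (d - 1) + j) mod m = i"
      using cyclic_index_covered[OF assms(1) i] .
    then have "C i \<in> set (Ds d)"
      by (force simp: Ds_def)
    then show ?thesis
      using fixed[OF d] sets_DR_operator_fixes_iff_Inter[where Ds = "Ds d" and u = l, OF Ds[of _ d] e] by blast
  qed
  moreover have "weakly_converges_to x l"
    \<comment> \<open>Norm convergence implies weak convergence by continuity of the inner
      product.\<close>
    unfolding weakly_converges_to_def by (intro allI tendsto_intros l)
  ultimately show ?thesis by blast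
qed

end
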